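(* Let $w_1,\dots,w_n,D$ be positive integers, $q_i=w_i/D$, and let $W(x_1,\dots,x_n)$ be a weighted homogeneous polynomial with $W(\lambda^{w_1}x_1,\dots,\lambda^{w_n}x_n)=\lambda^DW(x_1,\dots,x_n)$. Let $J_W=\mathrm{diag}(e^{2\pi i q_1},\dots,e^{2\pi i q_n})$ be the exponential grading operator and $\langle J_W\rangle$ the cyclic group it generates. Consider the Landau–Ginzburg phase $\mathbb{C}^n/\langle J_W\rangle$, i.e. the GIT quotient of $\mathbb{C}\times\mathbb{C}^n$ by the $\mathbb{C}^*$-action $\lambda\cdot(p,x_1,\dots,x_n)=(\lambda^{-D}p,\lambda^{w_1}x_1,\dots,\lambda^{w_n}x_n)$ for the linearization $\kappa(\lambda)=\lambda^k$, $k<0$, of the trivial bundle. Then the elliptic genus of this phase (relative to the origin, the only fixed point of the $\mathbb{C}^*$-action) coincides with the LG elliptic genus of $W$ with orbifoldization group $\langle J_W\rangle$.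
   Context: Theta function: $\theta(z,\tau)=e^{\pi i\tau/4}\,2\sin(\pi z)\prod_{l\ge1}(1-e^{2\pi i l\tau})(1-e^{2\pi i(l\tau+z)})(1-e^{2\pi i(l\tau-z)})$. Elliptic genus of the phase: the $\mathbb{C}^*$-action $s\cdot(p,x)=(sp,x)$ on $\mathbb{C}\times\mathbb{C}^n$ descends to the GIT quotient $\mathbb{C}^n/\langle J_W\rangle$ and lifts, after passing to a finite cover $\tilde T$ of $\mathbb{C}^*$, to a linear action on $\mathbb{C}^n$. Let $u$ be the infinitesimal generator of the character group of the $\mathbb{C}^*$ acting effectively on the quotient, and write the weights of the lifted action on the coordinates as $\rho_iu$ ($\rho_i\in\mathbb{Q}$). With $\Gamma=\langle J_W\rangle$ and $\lambda_i(g)\in[0,1)$ defined by $g\cdot x_i=e^{2\pi i\lambda_i(g)}x_i$, the equivariant orbifold elliptic genus at the origin is $$Ell^{\mathbb{C}^*}_{orb}(u,z,\tau)=\frac1{|\Gamma|}\sum_{g,h\in\Gamma}\prod_{i=1}^n\frac{\theta(\rho_iu+\lambda_i(g)-\lambda_i(h)\tau-z,\tau)}{\theta(\rho_iu+\lambda_i(g)-\lambda_i(h)\tau,\tau)}e^{2\pi i\lambda_i(h)z},$$ and the elliptic genus of the phase is its restriction to $u=z$. LG elliptic genus: for a finite abelian group $H$ of diagonal symmetries of $W$, with $h\in H$ acting on the $i$-th coordinate by $\exp(2\pi i\theta_i(h))$, $\theta_i(h)\in\mathbb{Q}$, the LG elliptic genus is $$\frac1{|H|}\sum_{h_a,h_b\in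 H}\prod_{i=1}^n e^{2\pi i\theta_i(h_a)z}\,\frac{\theta((q_i-1)z+\theta_i(h_b)-\tau\theta_i(h_a),\tau)}{\theta(q_iz+\theta_i(h_b)-\tau\theta_i(h_a),\tau)}$$ (independent of the choice of $\theta_i(h)$ modulo $\mathbb{Z}$). *)

theory Defs
  imports "HOL-Analysis.Analysis" "HOL-Library.Poly_Mapping"
begin

subsection \<open>Theta function\<close>

text \<open>Meaningful for \<open>Im \<tau> > 0\<close>; the product index \<open>l\<close> is shifted by one.\<close>

definition theta :: "complex \<Rightarrow> complex \<Rightarrow> complex" where
  "theta z \<tau> = exp (of_real pi * \<i> * \<tau> / 4) * (2 * sin (of_real pi * z)) *
     prodinf (\<lambda>l. (1 - exp (2 * of_real pi * \<i> * (of_nat (Suc l) * \<tau>))) *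
           (1 - exp (2 * of_real pi * \<i> * (of_nat (Suc l) * \<tau> + z))) *
           (1 - exp (2 * of_real pi * \<i> * (of_nat (Suc l) * \<tau> - z))))"

subsection \<open>Polynomials in finitely many variables\<close>

text \<open>
  A polynomial in variables indexed by \<open>'v\<close> is a finitely supported map from monomials
  (exponent vectors) to coefficients.
\<close>

definition mpoly_eval :: "(('v::finite \<Rightarrow>\<^sub>0 nat) \<Rightarrow>\<^sub>0 complex) \<Rightarrow> ('v \<Rightarrow> complex) \<Rightarrow> complex" where
  "mpoly_eval P x =
     (\<Sum>m\<in>Poly_Mapping.keys P. Poly_Mapping.lookup P m * (\<Prod>v\<in>UNIV. x v ^ Poly_Mapping.lookup m v))"

definition weighted_homogeneous ::
    "('n::finite \<Rightarrow> nat) \<Rightarrow> nat \<Rightarrow> (('n \<Rightarrow>\<^sub>0 nat) \<Rightarrow>\<^sub>0 complex) \<Rightarrow> bool" where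
  "weighted_homogeneous w D W \<longleftrightarrow>
     (\<forall>c x. mpoly_eval W (\<lambda>i. c ^ w i * x i) = c ^ D * mpoly_eval W x)"

subsection \<open>Diagonal symmetries\<close>

text \<open>
  A diagonal matrix is represented by the vector of its diagonal entries. The product of
  diagonal matrices, and the action of a diagonal matrix on a vector, are then both the
  componentwise product \<open>(*)\<close> of type \<open>vec\<close>.
\<close>

definition J_op :: "('n::finite \<Rightarrow> nat) \<Rightarrow> nat \<Rightarrow> complex ^ 'n" where
  "J_op w D = (\<chi> i. exp (2 * of_real pi * \<i> * (of_nat (w i) / of_nat D)))"

definition J_group :: "('n::finite \<Rightarrow> nat) \<Rightarrow> nat \<Rightarrow> (complex ^ 'n) set" where
  "J_group w D = {(\<chi> i. (J_op w D $ i) powi a) | a::int. True}"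

lemma J_group_root_of_unity:
  assumes "D > 0" "g \<in> J_group w D"
  obtains c where "c ^ D = 1" "g = (\<chi> i. c ^ w i)"
proof -
  obtain a :: int where a: "g = (\<chi> i. (J_op w D $ i) powi a)"
    using assms(2) unfolding J_group_def by blast
  define c :: complex where "c = exp (of_int a * (2 * of_real pi * \<i> / of_nat D))"
  have "c ^ D = exp (of_nat D * (of_int a * (2 * of_real pi * \<i> / of_nat D)))"
    unfolding c_def by (rule exp_of_nat_mult[symmetric])
  also have "of_nat D * (of_int a * (2 * of_real pi * \<i> / of_nat D)) =
      complex_of_real (2 * of_int a * pi) * \<i>"
    using assms(1) by (simp add: field_simps)
  also have "exp \<dots> = 1"
    by (rule exp_integer_2pi) auto
  finally have 1: "c ^ D = 1" .
  have "(J_op w D $ i) powi a = c ^ w i" for i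
  proof -
    have "(J_op w D $ i) powi a = exp (of_int a * (2 * of_real pi * \<i> * (of_nat (w i) / of_nat D)))"
      unfolding J_op_def vec_lambda_beta by (rule exp_power_int)
    also have "of_int a * (2 * of_real pi * \<i> * (of_nat (w i) / of_nat D)) =
        of_nat (w i) * (of_int a * (2 * of_real pi * \<i> / of_nat D) :: complex)"
      by (simp add: mult_ac)
    also have "exp \<dots> = c ^ w i"
      unfolding c_def by (rule exp_of_nat_mult)
    finally show ?thesis .
  qed
  with a 1 show ?thesis
    using that by simp
qed

lemma finite_J_group:
  assumes "D > 0"
  shows "finite (J_group w D)"
proof (rule finite_subset)
  show "J_group w D \<subseteq> (\<lambda>c. \<chi> i. c ^ w i) ` {c. c ^ D = 1}"
    using J_group_root_of_unity[OF assms] by blast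
  show "finite ((\<lambda>c. \<chi> i. c ^ w i) ` {c :: complex. c ^ D = 1})"
    using assms by (intro finite_imageI finite_roots_unity) simp
qed

lemma J_group_symmetry:
  assumes "weighted_homogeneous w D W" "D > 0" "g \<in> J_group w D"
  shows "mpoly_eval W (($) (g * x)) = mpoly_eval W (($) x)"
proof -
  obtain c where c: "c ^ D = 1" "g = (\<chi> i. c ^ w i)"
    using J_group_root_of_unity[OF assms(2,3)] .
  then have "($) (g * x) = (\<lambda>i. c ^ w i * x $ i)"
    by (simp add: fun_eq_iff)
  then show ?thesis
    using assms(1) c(1) unfolding weighted_homogeneous_def by simp
qed

subsection \<open>The GIT quotient\<close>

definition git_act ::
    "('n::finite \<Rightarrow> nat) \<Rightarrow> nat \<Rightarrow> complex \<Rightarrow> complex \<times> (complex ^ 'n) \<Rightarrow> complex \<times> (complex ^ 'n)" where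
  "git_act w D c y = (c powi (- int D) * fst y, \<chi> i. c ^ w i * snd y $ i)"

definition git_orbit ::
    "('n::finite \<Rightarrow> nat) \<Rightarrow> nat \<Rightarrow> complex \<times> (complex ^ 'n) \<Rightarrow> (complex \<times> (complex ^ 'n)) set" where
  "git_orbit w D y = {git_act w D c y | c. c \<noteq> 0}"

text \<open>The coordinate functions on \<open>\<complex> \<times> \<complex>\<^sup>n\<close>: \<open>None\<close> indexes \<open>p\<close> and \<open>Some i\<close> indexes \<open>x\<^sub>i\<close>.\<close>

definition coords :: "complex \<times> (complex ^ 'n::finite) \<Rightarrow> 'n option \<Rightarrow> complex" where
  "coords y v = (case v of None \<Rightarrow> fst y | Some i \<Rightarrow> snd y $ i)"

text \<open>
  The linearization by \<open>\<kappa>(c) = c\<^sup>k\<close> is \<open>c \<cdot> (y, v) = (c \<cdot> y, \<kappa>(c) v)\<close> on the trivial line bundle.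
  An invariant section of its \<open>m\<close>-th power is a polynomial \<open>F\<close> with
  \<open>F (c \<cdot> y) = \<kappa>(c)\<^sup>m F y\<close>. A point is semistable if some such section with \<open>m \<ge> 1\<close>
  does not vanish there.
\<close>

definition semistable ::
    "('n::finite \<Rightarrow> nat) \<Rightarrow> nat \<Rightarrow> int \<Rightarrow> complex \<times> (complex ^ 'n) \<Rightarrow> bool" where
  "semistable w D k y \<longleftrightarrow>
     (\<exists>m\<ge>1::nat. \<exists>F::('n option \<Rightarrow>\<^sub>0 nat) \<Rightarrow>\<^sub>0 complex.
        (\<forall>c y'. c \<noteq> 0 \<longrightarrow>
           mpoly_eval F (coords (git_act w D c y')) = (c powi k) ^ m * mpoly_eval F (coords y')) \<and>
        mpoly_eval F (coords y) \<noteq> 0)"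

text \<open>
  Two semistable points are identified in the GIT quotient when their orbit closures meet in the
  semistable locus. Orbit closures in the Zariski and in the Euclidean topology agree.
\<close>

definition git_class ::
    "('n::finite \<Rightarrow> nat) \<Rightarrow> nat \<Rightarrow> int \<Rightarrow> complex \<times> (complex ^ 'n) \<Rightarrow> (complex \<times> (complex ^ 'n)) set" where
  "git_class w D k y =
     {y'. semistable w D k y' \<and>
        closure (git_orbit w D y) \<inter> closure (git_orbit w D y') \<inter> Collect (semistable w D k) \<noteq> {}}"

definition git_quotient ::
    "('n::finite \<Rightarrow> nat) \<Rightarrow> nat \<Rightarrow> int \<Rightarrow> (complex \<times> (complex ^ 'n)) set set" where
  "git_quotient w D k = git_class w D k ` Collect (semistable w D k)"

text \<open>The map \<open>\<complex>\<^sup>n \<rightarrow> (\<complex> \<times> \<complex>\<^sup>n) // \<complex>\<^sup>*\<close> that induces the identification of the phase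
  \<open>k < 0\<close> with \<open>\<complex>\<^sup>n / \<langle>J\<^sub>W\<rangle>\<close>.\<close>

definition phase_chart ::
    "('n::finite \<Rightarrow> nat) \<Rightarrow> nat \<Rightarrow> int \<Rightarrow> complex ^ 'n \<Rightarrow> (complex \<times> (complex ^ 'n)) set" where
  "phase_chart w D k x = git_class w D k (1, x)"

subsection \<open>The residual action and its weights\<close>

definition res_act :: "complex \<Rightarrow> complex \<times> (complex ^ 'n::finite) \<Rightarrow> complex \<times> (complex ^ 'n)" where
  "res_act s y = (s * fst y, snd y)"

text \<open>The descended action of \<open>s\<close> sends a point \<open>C\<close> of the quotient to its image \<open>res_act s ` C\<close>.\<close>

definition fixed_points ::
    "('n::finite \<Rightarrow> nat) \<Rightarrow> nat \<Rightarrow> int \<Rightarrow> (complex \<times> (complex ^ 'n)) set set" where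
  "fixed_points w D k = {C \<in> git_quotient w D k. \<forall>s. s \<noteq> 0 \<longrightarrow> res_act s ` C = C}"

definition ineffective_kernel :: "('n::finite \<Rightarrow> nat) \<Rightarrow> nat \<Rightarrow> int \<Rightarrow> complex set" where
  "ineffective_kernel w D k = {s. s \<noteq> 0 \<and> (\<forall>C\<in>git_quotient w D k. res_act s ` C = C)}"

text \<open>
  A finite cover of \<open>\<complex>\<^sup>*\<close> is \<open>t \<mapsto> t\<^sup>m\<close>, and a lift of the action to the cover is given by
  integer weights \<open>a\<^sub>i\<close> with \<open>t \<cdot> x\<^sub>i = t\<^bsup>a\<^sub>i\<^esup> x\<^sub>i\<close>. If \<open>e\<close> is the order of the ineffective kernel,
  then \<open>s\<^sup>e\<close> is the coordinate of the torus acting effectively. Its character generator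
  \<open>u\<close> pulls back to \<open>m e\<close> times the generator on the cover, so the weight \<open>a\<^sub>i\<close> is
  \<open>\<rho>\<^sub>i u\<close> with \<open>\<rho>\<^sub>i = a\<^sub>i / (m e)\<close>.
\<close>

definition is_lifted_weights ::
    "('n::finite \<Rightarrow> nat) \<Rightarrow> nat \<Rightarrow> int \<Rightarrow> ('n \<Rightarrow> rat) \<Rightarrow> bool" where
  "is_lifted_weights w D k \<rho> \<longleftrightarrow>
     (\<exists>m\<ge>1::nat. \<exists>a::'n \<Rightarrow> int.
        (\<forall>t x. t \<noteq> 0 \<longrightarrow>
           phase_chart w D k (\<chi> i. t powi a i * x $ i) = res_act (t ^ m) ` phase_chart w D k x) \<and>
        (\<forall>i. \<rho> i = of_int (a i) / of_nat (m * card (ineffective_kernel w D k))))"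

definition lifted_weights :: "('n::finite \<Rightarrow> nat) \<Rightarrow> nat \<Rightarrow> int \<Rightarrow> 'n \<Rightarrow> rat" where
  "lifted_weights w D k = (THE \<rho>. is_lifted_weights w D k \<rho>)"

subsection \<open>Elliptic genera\<close>

definition lam :: "complex ^ 'n::finite \<Rightarrow> 'n \<Rightarrow> real" where
  "lam g i = (THE t. 0 \<le> t \<and> t < 1 \<and> g $ i = exp (2 * of_real pi * \<i> * of_real t))"

definition equiv_orb_ell ::
    "(complex ^ 'n::finite) set \<Rightarrow> ('n \<Rightarrow> rat) \<Rightarrow> complex \<Rightarrow> complex \<Rightarrow> complex \<Rightarrow> complex" where
  "equiv_orb_ell \<Gamma> \<rho> u z \<tau> =
     1 / of_nat (card \<Gamma>) *
     (\<Sum>g\<in>\<Gamma>. \<Sum>h\<in>\<Gamma>. \<Prod>i\<in>UNIV.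
        theta (of_rat (\<rho> i) * u + of_real (lam g i) - of_real (lam h i) * \<tau> - z) \<tau> /
        theta (of_rat (\<rho> i) * u + of_real (lam g i) - of_real (lam h i) * \<tau>) \<tau> *
        exp (2 * of_real pi * \<i> * of_real (lam h i) * z))"

definition phase_ell :: "('n::finite \<Rightarrow> nat) \<Rightarrow> nat \<Rightarrow> int \<Rightarrow> complex \<Rightarrow> complex \<Rightarrow> complex" where
  "phase_ell w D k z \<tau> = equiv_orb_ell (J_group w D) (lifted_weights w D k) z z \<tau>"

text \<open>The phases \<open>\<theta>\<^sub>i(h)\<close> are only determined modulo \<open>\<int>\<close>; a choice of them is a parameter of
  the LG elliptic genus.\<close>

definition is_phase_choice :: "(complex ^ 'n::finite) set \<Rightarrow> (complex ^ 'n \<Rightarrow> 'n \<Rightarrow> rat) \<Rightarrow> bool" where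
  "is_phase_choice H th \<longleftrightarrow> (\<forall>h\<in>H. \<forall>i. h $ i = exp (2 * of_real pi * \<i> * of_rat (th h i)))"

definition LG_ell ::
    "('n::finite \<Rightarrow> nat) \<Rightarrow> nat \<Rightarrow> (complex ^ 'n) set \<Rightarrow> (complex ^ 'n \<Rightarrow> 'n \<Rightarrow> rat) \<Rightarrow>
     complex \<Rightarrow> complex \<Rightarrow> complex" where
  "LG_ell w D H th z \<tau> =
     1 / of_nat (card H) *
     (\<Sum>ha\<in>H. \<Sum>hb\<in>H. \<Prod>i\<in>UNIV.
        exp (2 * of_real pi * \<i> * of_rat (th ha i) * z) *
        (theta ((of_nat (w i) / of_nat D - 1) * z + of_rat (th hb i) - \<tau> * of_rat (th ha i)) \<tau> /
         theta (of_nat (w i) / of_nat D * z + of_rat (th hb i) - \<tau> * of_rat (th ha i)) \<tau>))"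

end

theory Submission
  imports Defs
begin

text \<open>
  For \<open>k < 0\<close> a point \<open>(p, x)\<close> is semistable iff \<open>p \<noteq> 0\<close>, and orbits are closed in this locus.
  Every orbit meets the slice \<open>p = 1\<close>, in a single orbit of the \<open>D\<close>-th roots of unity, which act
  through \<open>\<langle>J\<^sub>W\<rangle>\<close>. On the slice, \<open>res_act s\<close> is represented by \<open>x\<^sub>i \<mapsto> c\<^bsup>w\<^sub>i\<^esup> x\<^sub>i\<close> with \<open>c\<^sup>D = s\<close>. Because a
  nonzero \<open>W\<close> is homogeneous of weighted degree \<open>D\<close>, this action is effective on the quotient, so the
  lifted weights are exactly \<open>\<rho>\<^sub>i = q\<^sub>i\<close>. At \<open>u = z\<close> the two genera then agree term by term with
  \<open>h = h\<^sub>a\<close> and \<open>g = h\<^sub>b\<close>: replacing \<open>\<lambda>\<^sub>i\<close> by another choice of phase modulo \<open>\<int>\<close> does not matter by the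
  quasi-periodicity of theta in the directions \<open>1\<close> and \<open>\<tau>\<close>.
\<close>

subsection \<open>Quasi-periodicity of theta\<close>

text \<open>The q-Pochhammer product (qy; q)_infinity. Each of the three factors of theta is one of
  these, at y = 1, e^(2 pi i z) and e^(-2 pi i z).\<close>

definition qpoch :: "complex \<Rightarrow> complex \<Rightarrow> complex" where
  "qpoch q y = prodinf (\<lambda>l. 1 - q ^ Suc l * y)"

lemma convergent_prod_qpoch:
  assumes "norm (q :: complex) < 1"
  shows "convergent_prod (\<lambda>l. 1 - q ^ Suc l * y)"
proof -
  have "summable (\<lambda>l. norm (q * y) * norm q ^ l)"
    using assms by (intro summable_mult summable_geometric) simp
  then have "summable (\<lambda>l. norm ((1 - q ^ Suc l * y) - 1))"
    by (simp add: norm_mult norm_power mult_ac)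
  then show ?thesis
    by (intro abs_convergent_prod_imp_convergent_prod) (simp add: abs_convergent_prod_conv_summable)
qed

text \<open>Splitting off the factor l = 0 of a partial product at y leaves a partial product at qy;
  then pass to the limit.\<close>

lemma qpoch_shift:
  assumes "norm q < 1"
  shows "qpoch q y = (1 - q * y) * qpoch q (q * y)"
proof (rule LIMSEQ_unique)
  have "(\<lambda>n. \<Prod>l\<le>n. 1 - q ^ Suc l * y) \<longlonglongrightarrow> qpoch q y"
    unfolding qpoch_def by (intro convergent_prod_LIMSEQ convergent_prod_qpoch assms)
  from LIMSEQ_Suc[OF this]
  show "(\<lambda>n. (1 - q * y) * (\<Prod>l\<le>n. 1 - q ^ Suc l * (q * y))) \<longlonglongrightarrow> qpoch q y"
    by (subst (asm) prod.atMost_Suc_shift) (simp add: mult_ac)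
  show "(\<lambda>n. (1 - q * y) * (\<Prod>l\<le>n. 1 - q ^ Suc l * (q * y))) \<longlonglongrightarrow> (1 - q * y) * qpoch q (q * y)"
    unfolding qpoch_def
    by (intro tendsto_mult tendsto_const convergent_prod_LIMSEQ convergent_prod_qpoch assms)
qed

lemma norm_nome:
  assumes "Im \<tau> > 0"
  shows "norm (exp (2 * of_real pi * \<i> * \<tau>)) < 1"
  using assms by simp

lemma theta_eq_qpoch:
  assumes "Im \<tau> > 0"
  defines "q \<equiv> exp (2 * of_real pi * \<i> * \<tau>)"
  shows "theta z \<tau> = exp (of_real pi * \<i> * \<tau> / 4) * (2 * sin (of_real pi * z)) *
    (qpoch q 1 * qpoch q (exp (2 * of_real pi * \<i> * z)) * qpoch q (exp (- (2 * of_real pi * \<i> * z))))"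
proof -
  have q: "norm q < 1"
    unfolding q_def by (rule norm_nome[OF assms(1)])
  have e: "exp (2 * of_real pi * \<i> * (of_nat n * \<tau> + x)) = q ^ n * exp (2 * of_real pi * \<i> * x)" for n x
  proof -
    have "2 * of_real pi * \<i> * (of_nat n * \<tau> + x) = of_nat n * (2 * of_real pi * \<i> * \<tau>) + 2 * of_real pi * \<i> * x"
      by (simp add: algebra_simps)
    then show ?thesis
      unfolding q_def by (simp only: exp_add exp_of_nat_mult)
  qed
  have "1 - exp (2 * of_real pi * \<i> * (of_nat n * \<tau>)) = 1 - q ^ n * 1"
       "1 - exp (2 * of_real pi * \<i> * (of_nat n * \<tau> + z)) = 1 - q ^ n * exp (2 * of_real pi * \<i> * z)"
       "1 - exp (2 * of_real pi * \<i> * (of_nat n * \<tau> - z)) = 1 - q ^ n * exp (- (2 * of_real pi * \<i> * z))"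
    for n
    using e[of n 0] e[of n z] e[of n "- z"] by simp_all
  then show ?thesis
    unfolding theta_def qpoch_def
    by (simp only: prodinf_mult convergent_prod_mult convergent_prod_qpoch q)
qed

lemma theta_add_1:
  assumes "Im \<tau> > 0"
  shows "theta (z + 1) \<tau> = - theta z \<tau>"
proof -
  have "sin (of_real pi * (z + 1)) = - sin (of_real pi * z)"
    by (simp add: distrib_left sin_add flip: sin_of_real cos_of_real)
  moreover have "exp (2 * of_real pi * \<i> * (z + 1)) = exp (2 * of_real pi * \<i> * z)"
    by (simp add: distrib_left exp_add)
  ultimately show ?thesis
    by (simp add: theta_eq_qpoch[OF assms] exp_minus)
qed

text \<open>With y = e^(2 pi i z), this exposes the factor 1 - 1/y, which would be the index-0 term
  of the product at 1/y.\<close>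

lemma two_sin_pi:
  "2 * sin (of_real pi * z) =
     - \<i> * exp (of_real pi * \<i> * z) * (1 - exp (- (2 * of_real pi * \<i> * z)))"
proof -
  have e: "exp (of_real pi * \<i> * z) * exp (- (2 * of_real pi * \<i> * z)) = exp (- (of_real pi * \<i> * z))"
    by (simp add: mult_ac flip: exp_add)
  have "2 * sin w = - \<i> * (exp (\<i> * w) - exp (- (\<i> * w)))" for w :: complex
    by (simp add: sin_exp_eq field_simps)
  from this[of "of_real pi * z"] e show ?thesis
    by (simp add: right_diff_distrib mult_ac)
qed

text \<open>The shift replaces y by qy: the product at y loses 1 - qy, the product at 1/y gains 1 -
  1/y, and the sine trades 1 - 1/y for r(1 - 1/(qy)) = -(1 - qy)/(ry).\<close>

lemma theta_add_tau:
  assumes "Im \<tau> > 0"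
  shows "theta (z + \<tau>) \<tau> = - exp (- (of_real pi * \<i> * \<tau>) - 2 * of_real pi * \<i> * z) * theta z \<tau>"
proof -
  define q where "q = exp (2 * of_real pi * \<i> * \<tau>)"
  define r where "r = exp (of_real pi * \<i> * \<tau>)"
  define y where "y = exp (2 * of_real pi * \<i> * z)"
  have nq: "norm q < 1"
    unfolding q_def by (rule norm_nome[OF assms])
  have nz: "r \<noteq> 0" "y \<noteq> 0" "q = r * r"
    by (simp_all add: r_def q_def y_def mult_ac flip: exp_add)
  have e: "exp (2 * of_real pi * \<i> * (z + \<tau>)) = q * y"
      "exp (- (2 * of_real pi * \<i> * (z + \<tau>))) = inverse (q * y)"
      "exp (of_real pi * \<i> * (z + \<tau>)) = r * exp (of_real pi * \<i> * z)"
      "exp (- (2 * of_real pi * \<i> * z)) = inverse y"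
      "exp (- (of_real pi * \<i> * \<tau>) - 2 * of_real pi * \<i> * z) = inverse (r * y)"
    by (simp_all add: q_def y_def r_def distrib_left exp_add exp_minus exp_diff field_simps)
  have s: "qpoch q y = (1 - q * y) * qpoch q (q * y)"
      "qpoch q (inverse (q * y)) = (1 - inverse y) * qpoch q (inverse y)"
    using qpoch_shift[OF nq, of y] qpoch_shift[OF nq, of "inverse (q * y)"] nz
    by (simp_all add: field_simps)
  have "r * (1 - inverse (q * y)) = - inverse (r * y) * (1 - q * y)"
    using nz by (simp add: field_simps)
  \<comment> \<open>Exponentials and products are abstracted to variables, leaving a polynomial
    identity. Nothing is divided by 1 - qy, so its zeros need no separate case.\<close>
  moreover have "r * (1 - u) = - v * (1 - x) \<Longrightarrow>
      a * (- \<i> * (r * b) * (1 - u)) * (c * d * (f * g)) = - v * (a * (- \<i> * b * f) * (c * ((1 - x) * d) * g))"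
    for a b c d f g u v x
    by algebra
  ultimately show ?thesis
    unfolding theta_eq_qpoch[OF assms] two_sin_pi e q_def[symmetric] y_def[symmetric] s
    by blast
qed

text \<open>At zeros of the denominator the quotient is the junk value \<open>0\<close>. The translation rules below
  hold there too, since translation multiplies numerator and denominator by nonzero factors.\<close>

definition theta_ratio :: "complex \<Rightarrow> complex \<Rightarrow> complex \<Rightarrow> complex" where
  "theta_ratio x z \<tau> = theta (x - z) \<tau> / theta x \<tau>"

lemma int_periodic:
  fixes f :: "int \<Rightarrow> 'a"
  assumes "\<And>n. f (n + 1) = f n"
  shows "f n = f 0"
proof (induction n rule: int_induct[where k = 0])
  case (step2 i)
  then show ?case
    using assms[of "i - 1"] by simp
qed (simp_all add: assms)

lemma theta_ratio_add_int:
  assumes "Im \<tau> > 0"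
  shows "theta_ratio (x + of_int n) z \<tau> = theta_ratio x z \<tau>"
proof -
  have "theta_ratio (x + 1) z \<tau> = theta_ratio x z \<tau>" for x
    using theta_add_1[OF assms, of x] theta_add_1[OF assms, of "x - z"]
    by (simp add: theta_ratio_def algebra_simps)
  then show ?thesis
    using int_periodic[of "\<lambda>n. theta_ratio (x + of_int n) z \<tau>" n]
    by (simp flip: add.assoc)
qed

text \<open>The multiplier of theta depends on the point; between x - z and x only e^(2 pi i z)
  survives.\<close>

lemma theta_ratio_add_tau:
  assumes "Im \<tau> > 0"
  shows "theta_ratio (x + \<tau>) z \<tau> = exp (2 * of_real pi * \<i> * z) * theta_ratio x z \<tau>"
proof -
  have "exp (- (of_real pi * \<i> * \<tau>) - 2 * of_real pi * \<i> * (x - z)) =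
      exp (2 * of_real pi * \<i> * z) * exp (- (of_real pi * \<i> * \<tau>) - 2 * of_real pi * \<i> * x)"
    by (simp add: algebra_simps flip: exp_add)
  then show ?thesis
    using theta_add_tau[OF assms, of x] theta_add_tau[OF assms, of "x - z"]
    by (simp add: theta_ratio_def algebra_simps)
qed

lemma theta_ratio_add_int_tau:
  assumes "Im \<tau> > 0"
  shows "theta_ratio (x + of_int n * \<tau>) z \<tau> = exp (2 * of_real pi * \<i> * (of_int n * z)) * theta_ratio x z \<tau>"
proof -
  \<comment> \<open>Dividing by the expected multiplier turns quasi-periodicity into periodicity,
    which covers negative n too.\<close>
  define f where "f n = exp (- (2 * of_real pi * \<i> * (of_int n * z))) * theta_ratio (x + of_int n * \<tau>) z \<tau>" for n
  have "f (n + 1) = f n" for n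
  proof -
    have "exp (- (2 * of_real pi * \<i> * (of_int (n + 1) * z))) * exp (2 * of_real pi * \<i> * z) =
        exp (- (2 * of_real pi * \<i> * (of_int n * z)))"
      by (simp add: algebra_simps flip: exp_add)
    moreover have "theta_ratio (x + of_int (n + 1) * \<tau>) z \<tau> =
        exp (2 * of_real pi * \<i> * z) * theta_ratio (x + of_int n * \<tau>) z \<tau>"
      using theta_ratio_add_tau[OF assms, of "x + of_int n * \<tau>" z] by (simp add: algebra_simps)
    ultimately show ?thesis
      by (simp only: f_def mult.assoc[symmetric])
  qed
  then have "f n = f 0"
    by (rule int_periodic)
  then show ?thesis
    by (simp add: f_def exp_minus field_simps)
qed

subsection \<open>Nonvanishing of nonzero polynomials\<close>

text \<open>Invertibility of the Vandermonde matrix, by interpolation: by linearity the weighted sum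
  of the values p(b m) vanishes for every polynomial p.\<close>

lemma power_sums_zero_imp_coeffs_zero:
  fixes a b :: "'m \<Rightarrow> complex"
  assumes "finite S" "inj_on b S" "\<And>j. (\<Sum>m\<in>S. a m * b m ^ j) = 0" "m0 \<in> S"
  shows "a m0 = 0"
proof -
  have *: "(\<Sum>m\<in>S. a m * poly p (b m)) = 0" for p
  proof -
    have "(\<Sum>m\<in>S. a m * poly p (b m)) = (\<Sum>j\<le>degree p. coeff p j * (\<Sum>m\<in>S. a m * b m ^ j))"
      unfolding poly_altdef sum_distrib_left
      by (subst sum.swap) (simp add: mult_ac)
    then show ?thesis
      using assms(3) by simp
  qed
  \<comment> \<open>Up to scaling, the Lagrange basis polynomial of the node
    \<open>b m0\<close>.\<close>
  define p where "p = (\<Prod>m\<in>S - {m0}. [:- b m, 1:])"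
  have "poly p (b m) = 0" if "m \<in> S - {m0}" for m
    unfolding p_def poly_prod using assms(1) that by (subst prod_zero_iff) auto
  then have "a m0 * poly p (b m0) = 0"
    using *[of p] assms(1,4) by (simp add: sum.remove[of S m0])
  moreover have "poly p (b m0) \<noteq> 0"
    unfolding p_def poly_prod using assms(1,2,4) by (subst prod_zero_iff) (auto dest: inj_onD)
  ultimately show ?thesis
    by simp
qed

lemma ex_inj_primes: "\<exists>p :: 'v::finite \<Rightarrow> nat. inj p \<and> (\<forall>v. prime (p v))"
proof -
  obtain B :: "nat set" where B: "finite B" "card B = CARD('v)" "B \<subseteq> {p. prime p}"
    using infinite_arbitrarily_large[OF primes_infinite] by blast
  then obtain f :: "'v \<Rightarrow> nat" where "f ` UNIV \<subseteq> B" "inj f"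
    using card_le_inj[of "UNIV :: 'v set" B] by auto
  then show ?thesis
    using B by blast
qed

text \<open>Substituting powers of distinct primes for the variables, distinct monomials take distinct
  values by unique factorization.\<close>

lemma mpoly_eval_nonzero:
  fixes P :: "('v::finite \<Rightarrow>\<^sub>0 nat) \<Rightarrow>\<^sub>0 complex"
  assumes "P \<noteq> 0"
  obtains x where "mpoly_eval P x \<noteq> 0"
proof (rule ccontr)
  assume "\<not> thesis"
  with that have zero: "mpoly_eval P x = 0" for x
    by blast
  obtain p :: "'v \<Rightarrow> nat" where p: "inj p" "\<And>v. prime (p v)"
    using ex_inj_primes by blast
  define b where "b m = (\<Prod>v\<in>UNIV. p v ^ Poly_Mapping.lookup m v)" for m :: "'v \<Rightarrow>\<^sub>0 nat"
  have mult: "multiplicity (p v) (b m) = Poly_Mapping.lookup m v" for m v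
  proof -
    have "b m = (\<Prod>r\<in>range p. r ^ Poly_Mapping.lookup m (inv p r))"
      unfolding b_def using p(1) by (simp add: prod.reindex)
    also have "multiplicity (p v) \<dots> = Poly_Mapping.lookup m v"
      using p by (subst multiplicity_prod_prime_powers) auto
    finally show ?thesis .
  qed
  have "inj b"
    by (rule injI, rule poly_mapping_eqI) (metis mult)
  then have inj: "inj_on (\<lambda>m. complex_of_nat (b m)) (Poly_Mapping.keys P)"
    by (auto simp: inj_on_def)
  have "(\<Sum>m\<in>Poly_Mapping.keys P. Poly_Mapping.lookup P m * complex_of_nat (b m) ^ j) = 0" for j
    using zero[of "\<lambda>v. of_nat (p v) ^ j"]
    by (simp add: mpoly_eval_def b_def prod_power_distrib mult_ac flip: power_mult)
  from power_sums_zero_imp_coeffs_zero[OF _ inj this]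
  have "Poly_Mapping.lookup P m = 0" if "m \<in> Poly_Mapping.keys P" for m
    using that by simp
  then show False
    using assms by (metis in_keys_iff poly_mapping_eqI lookup_zero)
qed

subsection \<open>The semistable locus and its orbits\<close>

lemma mpoly_eval_single:
  "mpoly_eval (Poly_Mapping.single (Poly_Mapping.single v n) 1) x = x v ^ n"
proof -
  have "x u ^ Poly_Mapping.lookup (Poly_Mapping.single v n) u = (if u = v then x v ^ n else 1)" for u
    by (simp add: lookup_single)
  then show ?thesis
    by (simp add: mpoly_eval_def)
qed

lemma continuous_mpoly_eval [continuous_intros]:
  assumes "\<And>v. continuous_on S (\<lambda>c. f c v)"
  shows "continuous_on S (\<lambda>c. mpoly_eval P (f c))"
  unfolding mpoly_eval_def by (intro continuous_intros assms)

lemma semistable_iff: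
  fixes w :: "'n::finite \<Rightarrow> nat"
  assumes "D > 0" "k < 0"
  shows "semistable w D k y \<longleftrightarrow> fst y \<noteq> 0"
proof
  \<comment> \<open>The monomial p^(-k) scales by c^(kD), so it is an invariant section of the power
    m = D.\<close>
  define F :: "('n option \<Rightarrow>\<^sub>0 nat) \<Rightarrow>\<^sub>0 complex"
    where "F = Poly_Mapping.single (Poly_Mapping.single None (nat (- k))) 1"
  have F: "mpoly_eval F (coords y) = fst y ^ nat (- k)" for y :: "complex \<times> (complex ^ 'n)"
    by (simp add: F_def mpoly_eval_single coords_def)
  have "(c powi (- int D)) ^ nat (- k) = (c powi k) ^ D" for c :: complex
  proof -
    have "(c powi (- int D)) ^ nat (- k) = c powi ((- int D) * int (nat (- k)))"
      by (simp only: power_int_mult power_int_of_nat)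
    also have "(- int D) * int (nat (- k)) = k * int D"
      using assms(2) by simp
    finally show ?thesis
      by (simp only: power_int_mult power_int_of_nat)
  qed
  then have "mpoly_eval F (coords (git_act w D c y')) = (c powi k) ^ D * mpoly_eval F (coords y')" for c y'
    by (simp add: F git_act_def power_mult_distrib)
  moreover assume "fst y \<noteq> 0"
  ultimately show "semistable w D k y"
    unfolding semistable_def using assms(1) F[of y]
    by (intro exI[of _ D] conjI exI[of _ F]) auto
next
  assume "semistable w D k y"
  then obtain m and F :: "('n option \<Rightarrow>\<^sub>0 nat) \<Rightarrow>\<^sub>0 complex" where m: "m \<ge> 1"
    and F: "\<And>c y'. c \<noteq> 0 \<Longrightarrow>
           mpoly_eval F (coords (git_act w D c y')) = (c powi k) ^ m * mpoly_eval F (coords y')"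
      "mpoly_eval F (coords y) \<noteq> 0"
    unfolding semistable_def by blast
  \<comment> \<open>If p = 0, the point c.y tends to the origin as c tends to 0, while F(c.y) =
    c^(km) F(y). Multiplying by c^N with N = -km > 0 gives the constant F(y), whose limit would be
    0.\<close>
  define N where "N = nat (- k) * m"
  show "fst y \<noteq> 0"
  proof
    assume p: "fst y = 0"
    define G where "G c = mpoly_eval F (coords (0, \<chi> i. c ^ w i * snd y $ i))" for c :: complex
    have "continuous_on UNIV (\<lambda>c. coords (0, \<chi> i. c ^ w i * snd y $ i) v)" for v :: "'n option"
      by (cases v) (auto simp: coords_def intro!: continuous_intros)
    then have "continuous_on UNIV G"
      unfolding G_def by (intro continuous_intros)
    then have "((\<lambda>c. c ^ N * G c) \<longlongrightarrow> 0 ^ N * G 0) (at 0)"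
      by (intro tendsto_intros) (simp add: continuous_on_def)
    moreover have "c ^ N * G c = mpoly_eval F (coords y)" if "c \<noteq> 0" for c
    proof -
      have "c ^ N * (c powi k) ^ m = (c powi (- k) * c powi k) ^ m"
        using assms(2) by (simp add: N_def power_mult power_mult_distrib power_int_def)
      also have "\<dots> = 1"
        using that by (simp flip: power_int_add)
      finally show ?thesis
        using F(1)[OF that, of y] p by (simp add: G_def git_act_def)
    qed
    then have "((\<lambda>c. c ^ N * G c) \<longlongrightarrow> mpoly_eval F (coords y)) (at 0)"
      by (intro tendsto_eventually) (auto simp: eventually_at_filter)
    ultimately have "0 ^ N * G 0 = mpoly_eval F (coords y)"
      by (rule tendsto_unique[rotated]) simp
    moreover have "N > 0"
      using m assms(2) by (simp add: N_def)
    ultimately show False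
      using F(2) by (simp add: zero_power)
  qed
qed

lemma git_act_mult:
  "git_act w D c (git_act w D d y) = git_act w D (c * d) y"
  by (simp add: git_act_def power_int_mult_distrib power_mult_distrib mult.assoc)

lemma git_orbit_eq:
  assumes "y' \<in> git_orbit w D y"
  shows "git_orbit w D y' = git_orbit w D y"
proof -
  obtain d where d: "d \<noteq> 0" "y' = git_act w D d y"
    using assms unfolding git_orbit_def by blast
  have "git_act w D c y = git_act w D (c / d) y'" "git_act w D c y' = git_act w D (c * d) y" for c
    using d by (simp_all add: git_act_mult)
  moreover have "c / d \<noteq> 0" "c * d \<noteq> 0" if "c \<noteq> 0" for c
    using that d(1) by simp_all
  ultimately show ?thesis
    unfolding git_orbit_def set_eq_iff mem_Collect_eq by metis
qed

text \<open>Moving the negative power of c to the other side makes the conditions polynomial in c,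
  which suits both limits and root extraction.\<close>

lemma mem_git_orbit_iff:
  "(p', x') \<in> git_orbit w D (p, x) \<longleftrightarrow> (\<exists>c. c \<noteq> 0 \<and> p' * c ^ D = p \<and> x' = (\<chi> i. c ^ w i * x $ i))"
proof -
  have "p' = c powi (- int D) * p \<longleftrightarrow> p' * c ^ D = p" if "c \<noteq> 0" for c :: complex
    using that by (auto simp: power_int_minus field_simps)
  then show ?thesis
    unfolding git_orbit_def git_act_def by auto
qed

lemma self_mem_git_orbit: "y \<in> git_orbit w D y"
proof -
  have "(fst y, snd y) \<in> git_orbit w D (fst y, snd y)"
    unfolding mem_git_orbit_iff by (intro exI[of _ 1]) (simp add: vec_eq_iff)
  then show ?thesis
    by simp
qed

text \<open>Orbits are closed in the semistable locus: if \<open>c\<^sub>n \<cdot> y\<close> converges there, then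
  \<open>c\<^sub>n\<^sup>D\<close> converges, so the \<open>c\<^sub>n\<close> are bounded and have a convergent subsequence.\<close>

lemma closure_git_orbit:
  assumes "D > 0" "y' \<in> closure (git_orbit w D y)" "fst y' \<noteq> 0" "fst y \<noteq> 0"
  shows "y' \<in> git_orbit w D y"
proof -
  obtain u where u: "\<And>n. u n \<in> git_orbit w D y" "u \<longlonglongrightarrow> y'"
    using assms(2) unfolding closure_sequential by blast
  have "\<exists>c. \<forall>n. c n \<noteq> 0 \<and> fst (u n) * c n ^ D = fst y \<and> snd (u n) = (\<chi> i. c n ^ w i * snd y $ i)"
  proof (intro choice allI)
    fix n
    show "\<exists>c. c \<noteq> 0 \<and> fst (u n) * c ^ D = fst y \<and> snd (u n) = (\<chi> i. c ^ w i * snd y $ i)"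
      using u(1)[of n] mem_git_orbit_iff[of "fst (u n)" "snd (u n)" w D "fst y" "snd y"] by simp
  qed
  then obtain c where c: "\<And>n. c n \<noteq> 0" "\<And>n. fst (u n) * c n ^ D = fst y"
      "\<And>n. snd (u n) = (\<chi> i. c n ^ w i * snd y $ i)"
    by auto
  have nz: "fst (u n) \<noteq> 0" for n
    using c(2)[of n] assms(4) by auto
  have cD: "c n ^ D = fst y / fst (u n)" for n
    using c(2)[of n] nz[of n] by (simp add: field_simps)
  have fu: "(\<lambda>n. fst (u n)) \<longlonglongrightarrow> fst y'" and su: "(\<lambda>n. snd (u n)) \<longlonglongrightarrow> snd y'"
    using u(2) by (auto intro: tendsto_fst tendsto_snd)
  have lim: "(\<lambda>n. c n ^ D) \<longlonglongrightarrow> fst y / fst y'"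
    unfolding cD by (intro tendsto_intros fu assms)
  then obtain K where K: "\<And>n. norm (c n ^ D) \<le> K"
    using convergent_imp_Bseq[OF convergentI[OF lim]] by (auto simp: Bseq_def)
  have "norm (c n) \<le> max 1 K" for n
  proof (cases "norm (c n) \<le> 1")
    case False
    then have "norm (c n) \<le> norm (c n) ^ D"
      using assms(1) by (intro self_le_power) auto
    then show ?thesis
      using K[of n] by (simp add: norm_power)
  qed simp
  then have "bounded (range c)"
    by (auto simp: bounded_iff)
  then obtain d r where r: "strict_mono r" "(c \<circ> r) \<longlonglongrightarrow> d"
    using bounded_imp_convergent_subsequence by blast
  have cr: "(\<lambda>n. c (r n)) \<longlonglongrightarrow> d"
    using r(2) by (simp add: o_def)
  have "(\<lambda>n. c (r n) ^ D) \<longlonglongrightarrow> fst y / fst y'"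
    using LIMSEQ_subseq_LIMSEQ[OF lim r(1)] by (simp add: o_def)
  moreover have "(\<lambda>n. c (r n) ^ D) \<longlonglongrightarrow> d ^ D"
    by (intro tendsto_intros cr)
  ultimately have dD: "d ^ D = fst y / fst y'"
    using LIMSEQ_unique by blast
  have "(\<lambda>n. snd (u (r n))) \<longlonglongrightarrow> snd y'"
    using LIMSEQ_subseq_LIMSEQ[OF su r(1)] by (simp add: o_def)
  moreover have "(\<lambda>n. snd (u (r n))) \<longlonglongrightarrow> (\<chi> i. d ^ w i * snd y $ i)"
    unfolding c(3) by (intro tendsto_intros cr)
  ultimately have "snd y' = (\<chi> i. d ^ w i * snd y $ i)"
    using LIMSEQ_unique by blast
  \<comment> \<open>The limit stays in the torus because its D-th power is a quotient of nonzero
    numbers.\<close>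
  moreover have "d \<noteq> 0"
    using dD assms by (auto simp: power_0_left)
  ultimately have "(fst y', snd y') \<in> git_orbit w D (fst y, snd y)"
    unfolding mem_git_orbit_iff using dD assms(3) by (intro exI[of _ d]) simp
  then show ?thesis
    by simp
qed

text \<open>A semistable point common to two orbit closures lies in both orbits, since they are
  closed in that locus; hence the orbits coincide.\<close>

lemma git_class_eq_orbit:
  assumes "D > 0" "k < 0" "fst y \<noteq> 0"
  shows "git_class w D k y = git_orbit w D y"
proof (intro equalityI subsetI)
  fix y' assume "y' \<in> git_class w D k y"
  then obtain v where v: "fst y' \<noteq> 0" "v \<in> closure (git_orbit w D y)" "v \<in> closure (git_orbit w D y')"
      "fst v \<noteq> 0"
    unfolding git_class_def by (auto simp: semistable_iff[OF assms(1,2)])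
  have "git_orbit w D v = git_orbit w D y'" "git_orbit w D v = git_orbit w D y"
    by (intro git_orbit_eq closure_git_orbit assms v)+
  then show "y' \<in> git_orbit w D y"
    using self_mem_git_orbit[of y' w D] by simp
next
  fix y' assume y': "y' \<in> git_orbit w D y"
  then have "fst y' \<noteq> 0"
    using assms(3) by (auto simp: git_orbit_def git_act_def)
  moreover have "y \<in> closure (git_orbit w D y) \<inter> closure (git_orbit w D y')"
    unfolding git_orbit_eq[OF y'] using subsetD[OF closure_subset self_mem_git_orbit] by simp
  ultimately show "y' \<in> git_class w D k y"
    using assms unfolding git_class_def by (auto simp: semistable_iff[OF assms(1,2)])
qed

lemma git_orbit_eq_iff: "git_orbit w D y = git_orbit w D y' \<longleftrightarrow> y' \<in> git_orbit w D y"
  using git_orbit_eq[of y' w D y] self_mem_git_orbit[of y' w D] by auto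

lemma res_act_git_orbit: "res_act s ` git_orbit w D (p, x) = git_orbit w D (s * p, x)"
proof -
  have "res_act s (git_act w D c (p, x)) = git_act w D c (s * p, x)" for c
    by (simp add: res_act_def git_act_def)
  then show ?thesis
    unfolding git_orbit_def by (simp add: setcompr_eq_image image_image)
qed

subsection \<open>The chart of the phase\<close>

lemma phase_chart_eq_orbit:
  assumes "D > 0" "k < 0"
  shows "phase_chart w D k x = git_orbit w D (1, x)"
  unfolding phase_chart_def by (simp add: git_class_eq_orbit assms)

lemma ex_complex_root:
  assumes "D > 0" "p \<noteq> (0::complex)"
  obtains c where "c \<noteq> 0" "c ^ D = p"
proof
  have "exp (ln p / of_nat D) ^ D = exp (of_nat D * (ln p / of_nat D))"
    by (rule exp_of_nat_mult[symmetric])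
  then show "exp (ln p / of_nat D) ^ D = p"
    using assms by simp
qed simp

lemma range_phase_chart:
  assumes "D > 0" "k < 0"
  shows "range (phase_chart w D k) = git_quotient w D k"
proof (intro equalityI subsetI)
  fix C assume "C \<in> git_quotient w D k"
  then obtain p x where p: "p \<noteq> 0" "C = git_orbit w D (p, x)"
    unfolding git_quotient_def by (auto simp: semistable_iff[OF assms] git_class_eq_orbit assms)
  \<comment> \<open>Acting by a D-th root of p normalizes the first coordinate to 1.\<close>
  obtain c where "c \<noteq> 0" "c ^ D = p"
    using ex_complex_root[OF assms(1) p(1)] .
  then have "(1, \<chi> i. c ^ w i * x $ i) \<in> git_orbit w D (p, x)"
    by (auto simp: mem_git_orbit_iff)
  then have "C = phase_chart w D k (\<chi> i. c ^ w i * x $ i)"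
    unfolding p(2) phase_chart_eq_orbit[OF assms] by (rule git_orbit_eq[symmetric])
  then show "C \<in> range (phase_chart w D k)"
    by blast
qed (auto simp: git_quotient_def phase_chart_def semistable_iff[OF assms])

text \<open>Every D-th root of unity is a power of e^(2 pi i/D), whose image under c ->
  diag(c^(w_i)) is \<open>J_op w D\<close>.\<close>

lemma mem_J_group_iff:
  assumes "D > 0"
  shows "g \<in> J_group w D \<longleftrightarrow> (\<exists>c. c ^ D = 1 \<and> g = (\<chi> i. c ^ w i))"
proof
  assume "\<exists>c. c ^ D = 1 \<and> g = (\<chi> i. c ^ w i)"
  then obtain c where c: "c ^ D = 1" "g = (\<chi> i. c ^ w i)"
    by blast
  then obtain j where j: "c = exp (2 * of_real pi * \<i> * of_nat j / of_nat D)"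
    using complex_roots_unity[of D] assms by auto
  have "c ^ w i = J_op w D $ i powi int j" for i
    unfolding j J_op_def by (simp add: mult_ac flip: exp_of_nat_mult)
  then show "g \<in> J_group w D"
    using c(2) unfolding J_group_def by (auto intro: exI[of _ "int j"])
qed (use J_group_root_of_unity[OF assms] in blast)

lemma phase_chart_eq_iff:
  assumes "D > 0" "k < 0"
  shows "phase_chart w D k x = phase_chart w D k y \<longleftrightarrow> (\<exists>g\<in>J_group w D. y = g * x)"
proof -
  have "phase_chart w D k x = phase_chart w D k y \<longleftrightarrow>
      (\<exists>c. c \<noteq> 0 \<and> c ^ D = 1 \<and> y = (\<chi> i. c ^ w i * x $ i))"
    by (simp add: phase_chart_eq_orbit assms git_orbit_eq_iff mem_git_orbit_iff)
  also have "\<dots> \<longleftrightarrow> (\<exists>g\<in>J_group w D. y = g * x)"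
  proof safe
    fix c :: complex assume "c ^ D = 1"
    then show "\<exists>g\<in>J_group w D. (\<chi> i. c ^ w i * x $ i) = g * x"
      by (intro bexI[of _ "\<chi> i. c ^ w i"]) (auto simp: mem_J_group_iff[OF assms(1)] vec_eq_iff)
  next
    fix g assume "g \<in> J_group w D"
    then obtain c where c: "c ^ D = 1" "g = (\<chi> i. c ^ w i)"
      using J_group_root_of_unity[OF assms(1)] by blast
    then have "c \<noteq> 0"
      using assms(1) by (auto simp: power_0_left)
    then show "\<exists>c. c \<noteq> 0 \<and> c ^ D = 1 \<and> g * x = (\<chi> i. c ^ w i * x $ i)"
      using c by (intro exI[of _ c]) (simp add: vec_eq_iff)
  qed
  finally show ?thesis .
qed

section \<open>Fixed points and effectiveness of the residual action\<close>

lemma res_act_fixes_phase_chart_iff: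
  assumes "D > 0" "k < 0"
  shows "res_act s ` phase_chart w D k x = phase_chart w D k x \<longleftrightarrow>
    (\<exists>c. c \<noteq> 0 \<and> c ^ D = s \<and> (\<forall>i. c ^ w i * x $ i = x $ i))"
proof -
  \<comment> \<open>Returning from (s, x) to the slice p = 1 uses a D-th root c of s, and x must be
    fixed by one such c.\<close>
  have "res_act s ` phase_chart w D k x = phase_chart w D k x \<longleftrightarrow>
      (\<exists>c. c \<noteq> 0 \<and> 1 * c ^ D = s * 1 \<and> x = (\<chi> i. c ^ w i * x $ i))"
    unfolding phase_chart_eq_orbit[OF assms] res_act_git_orbit git_orbit_eq_iff mem_git_orbit_iff ..
  moreover have "x = (\<chi> i. c ^ w i * x $ i) \<longleftrightarrow> (\<forall>i. c ^ w i * x $ i = x $ i)" for c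
    unfolding vec_eq_iff vec_lambda_beta by metis
  ultimately show ?thesis
    by simp
qed

lemma fixed_points_eq:
  assumes "D > 0" "k < 0" "\<And>i. w i > 0"
  shows "fixed_points w D k = {phase_chart w D k 0}"
proof -
  have "(\<forall>s. s \<noteq> 0 \<longrightarrow> res_act s ` phase_chart w D k x = phase_chart w D k x) \<longleftrightarrow> x = 0" for x
  proof
    assume "\<forall>s. s \<noteq> 0 \<longrightarrow> res_act s ` phase_chart w D k x = phase_chart w D k x"
    \<comment> \<open>One test element suffices: all D-th roots of 2^D have modulus 2, so no c^(w_i)
      equals 1.\<close>
    then have "res_act (2 ^ D) ` phase_chart w D k x = phase_chart w D k x"
      by simp
    then obtain c where c: "c ^ D = 2 ^ D" "\<And>i. c ^ w i * x $ i = x $ i"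
      unfolding res_act_fixes_phase_chart_iff[OF assms(1,2)] by blast
    then have "norm c ^ D = 2 ^ D"
      by (metis norm_numeral norm_power)
    then have "norm c = 2"
      using assms(1) by (simp add: power_eq_iff_eq_base)
    then have "c ^ w i \<noteq> 1" for i
      using assms(3)[of i] by (metis norm_one norm_power one_less_power one_less_numeral_iff semiring_norm(76) order_less_irrefl)
    with c(2) show "x = 0"
      by (simp add: vec_eq_iff)
  next
    assume "x = 0"
    then show "\<forall>s. s \<noteq> 0 \<longrightarrow> res_act s ` phase_chart w D k x = phase_chart w D k x"
      unfolding res_act_fixes_phase_chart_iff[OF assms(1,2)]
      using ex_complex_root[OF assms(1)] by (metis mult_zero_right zero_index)
  qed
  then show ?thesis
    unfolding fixed_points_def range_phase_chart[OF assms(1,2), symmetric] by auto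
qed

text \<open>A nonzero \<open>W\<close> of weighted degree \<open>D\<close> makes the residual action effective: if all \<open>c\<^bsup>w\<^sub>i\<^esup>\<close>
  are \<open>1\<close>, then homogeneity at a point where \<open>W\<close> does not vanish gives \<open>c\<^sup>D = 1\<close>.\<close>

lemma ineffective_kernel_eq:
  assumes "D > 0" "k < 0" "W \<noteq> 0" "weighted_homogeneous w D W"
  shows "ineffective_kernel w D k = {1}"
proof -
  have "s = 1" if s: "\<forall>x. res_act s ` phase_chart w D k x = phase_chart w D k x" for s
  proof -
    \<comment> \<open>At the all-ones point, being fixed forces every c^(w_i) to be 1.\<close>
    obtain c where c: "c ^ D = s" "\<And>i. c ^ w i = 1"
      using s[rule_format, of "\<chi> i. 1"] unfolding res_act_fixes_phase_chart_iff[OF assms(1,2)] by auto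
    obtain x where "mpoly_eval W x \<noteq> 0"
      using mpoly_eval_nonzero[OF assms(3)] .
    moreover have "mpoly_eval W (\<lambda>i. c ^ w i * x i) = c ^ D * mpoly_eval W x"
      using assms(4) unfolding weighted_homogeneous_def by blast
    ultimately show "s = 1"
      using c by simp
  qed
  moreover have "res_act 1 ` C = C" for C :: "(complex \<times> (complex ^ 'n)) set"
    by (simp add: res_act_def)
  ultimately show ?thesis
    unfolding ineffective_kernel_def range_phase_chart[OF assms(1,2), symmetric] by auto
qed

section \<open>Uniqueness and existence of the lifted weights\<close>

lemma lift_weight_eq:
  assumes "D > 0" "k < 0"
  assumes lift: "\<And>t x. t \<noteq> 0 \<Longrightarrow>
    phase_chart w D k (\<chi> i. t powi a i * x $ i) = res_act (t ^ m) ` phase_chart w D k x"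
  shows "a i * int D = int m * int (w i)"
proof -
  \<comment> \<open>Testing t = 2 on the all-ones vector gives c with c^D = 2^m and c^(w_i) =
    2^(a_i); eliminating c relates the exponents.\<close>
  have "(1, \<chi> i. 2 powi a i) \<in> git_orbit w D (2 ^ m, \<chi> i. 1)"
    using lift[of 2 "\<chi> i. 1"] self_mem_git_orbit[of "(1, \<chi> i. 2 powi a i)" w D]
    by (simp add: phase_chart_eq_orbit res_act_git_orbit assms)
  then obtain c :: complex where c: "c ^ D = 2 ^ m" "2 powi a i = c ^ w i"
    unfolding mem_git_orbit_iff by (auto simp: vec_eq_iff)
  have "(2 :: complex) powi (a i * int D) = (2 powi a i) ^ D"
    by (simp add: power_int_mult)
  also have "\<dots> = (c ^ D) ^ w i"
    by (simp add: c(2) mult.commute flip: power_mult)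
  also have "\<dots> = 2 powi (int m * int (w i))"
    by (simp add: c(1) power_int_mult)
  \<comment> \<open>Over the reals the powers of 2 are strictly increasing, so the exponents can be
    compared.\<close>
  finally have "norm ((2 :: complex) powi (a i * int D)) = norm ((2 :: complex) powi (int m * int (w i)))"
    by simp
  then have "(2 :: real) powi (a i * int D) = 2 powi (int m * int (w i))"
    by (simp only: norm_power_int norm_numeral)
  then show ?thesis
    by (metis linorder_neqE_linordered_idom one_less_numeral_iff order_less_irrefl
        power_int_strict_increasing semiring_norm(76))
qed

lemma is_lifted_weights_iff:
  assumes "D > 0" "k < 0" "card (ineffective_kernel w D k) = 1"
  shows "is_lifted_weights w D k \<rho> \<longleftrightarrow> \<rho> = (\<lambda>i. of_nat (w i) / of_nat D)"
proof
  assume "is_lifted_weights w D k \<rho>"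
  then obtain m a where m: "m \<ge> 1" "\<And>i. \<rho> i = of_int (a i) / of_nat m" and
    "\<And>t x. t \<noteq> 0 \<Longrightarrow>
       phase_chart w D k (\<chi> i. t powi a i * x $ i) = res_act (t ^ m) ` phase_chart w D k x"
    unfolding is_lifted_weights_def by (auto simp: assms)
  then have "a i * int D = int m * int (w i)" for i
    using lift_weight_eq[OF assms(1,2)] by blast
  then have "(of_int (a i * int D) :: rat) = of_int (int m * int (w i))" for i
    by simp
  then show "\<rho> = (\<lambda>i. of_nat (w i) / of_nat D)"
    using m assms(1) by (simp add: fun_eq_iff frac_eq_eq mult_ac)
next
  assume \<rho>: "\<rho> = (\<lambda>i. of_nat (w i) / of_nat D)"
  \<comment> \<open>The cover t -> t^D with weights a_i = w_i works: acting by t takes (t^D, x) back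
    to the slice p = 1.\<close>
  have "phase_chart w D k (\<chi> i. t powi int (w i) * x $ i) = res_act (t ^ D) ` phase_chart w D k x"
    if "t \<noteq> 0" for t x
    unfolding phase_chart_eq_orbit[OF assms(1,2)] res_act_git_orbit using that
    by (intro git_orbit_eq) (auto simp: mem_git_orbit_iff)
  then show "is_lifted_weights w D k \<rho>"
    unfolding is_lifted_weights_def using assms \<rho>
    by (intro exI[of _ D] conjI exI[of _ "\<lambda>i. int (w i)"]) auto
qed

lemma lifted_weights_eq:
  assumes "D > 0" "k < 0" "card (ineffective_kernel w D k) = 1"
  shows "lifted_weights w D k = (\<lambda>i. of_nat (w i) / of_nat D)"
  unfolding lifted_weights_def by (rule the_equality) (simp_all add: is_lifted_weights_iff[OF assms])

subsection \<open>Comparison of the elliptic genera\<close>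

lemma lam_eq_frac:
  assumes "g $ i = exp (2 * of_real pi * \<i> * of_real r)"
  shows "lam g i = frac r"
proof -
  have uniq: "t = frac r" if t: "0 \<le> t" "t < 1" "exp (2 * of_real pi * \<i> * of_real r) = exp (2 * of_real pi * \<i> * of_real t)" for t
  proof -
    obtain n :: int where "2 * of_real pi * \<i> * of_real r = 2 * of_real pi * \<i> * of_real t + (of_int (2 * n) * pi) * \<i>"
      using t(3) unfolding exp_eq by blast
    then have "Im (2 * of_real pi * \<i> * of_real r) = Im (2 * of_real pi * \<i> * of_real t + (of_int (2 * n) * pi) * \<i>)"
      by simp
    then have "pi * r = pi * (t + of_int n)"
      by (simp add: algebra_simps)
    then have "r = t + of_int n"
      by simp
    then show ?thesis
      using t(1,2) by (simp add: frac_unique_iff)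
  qed
  have "exp (2 * of_real pi * \<i> * of_real r) = exp (2 * of_real pi * \<i> * of_real (frac r))"
  proof -
    have "exp (2 * of_real pi * \<i> * of_int \<lfloor>r\<rfloor>) = 1"
      using exp_integer_2pi[of "of_int \<lfloor>r\<rfloor>"] by (simp add: mult_ac)
    then show ?thesis
      by (simp add: frac_def right_diff_distrib exp_diff)
  qed
  then show ?thesis
    unfolding lam_def assms using uniq by (intro the_equality) (auto simp: frac_lt_1)
qed

lemma phase_choice_eq_lam:
  assumes "is_phase_choice H th" "h \<in> H"
  obtains n :: int where "complex_of_rat (th h i) = of_real (lam h i) + of_int n"
proof -
  have r: "complex_of_rat q = of_real (of_rat q)" for q
    by (cases q) (simp add: of_rat_rat)
  have "h $ i = exp (2 * of_real pi * \<i> * of_real (of_rat (th h i)))"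
    using assms unfolding is_phase_choice_def r by blast
  then have "complex_of_rat (th h i) = of_real (lam h i) + of_int \<lfloor>real_of_rat (th h i)\<rfloor>"
    using lam_eq_frac[of h i "of_rat (th h i)"] by (simp add: r frac_def)
  then show ?thesis
    by (rule that)
qed

text \<open>Changing b by n is invisible. Changing a by m moves the argument by -m tau, and the
  resulting e^(-2 pi i m z) cancels the change of the prefactor.\<close>

lemma genus_factor_eq:
  assumes "Im \<tau> > 0" "b' = b + of_int n" "a' = a + of_int m"
  shows "exp (2 * of_real pi * \<i> * a' * z) * theta_ratio (x + b' - \<tau> * a') z \<tau> =
    theta_ratio (x + b - a * \<tau>) z \<tau> * exp (2 * of_real pi * \<i> * a * z)"
proof -
  have "x + b' - \<tau> * a' = (x + b - a * \<tau>) + of_int (- m) * \<tau> + of_int n"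
    using assms by (simp add: algebra_simps)
  then have "theta_ratio (x + b' - \<tau> * a') z \<tau> =
      exp (2 * of_real pi * \<i> * (of_int (- m) * z)) * theta_ratio (x + b - a * \<tau>) z \<tau>"
    by (simp only: theta_ratio_add_int[OF assms(1)] theta_ratio_add_int_tau[OF assms(1)])
  moreover have "exp (2 * of_real pi * \<i> * a' * z) * exp (2 * of_real pi * \<i> * (of_int (- m) * z)) =
      exp (2 * of_real pi * \<i> * a * z)"
    unfolding assms by (simp add: algebra_simps flip: exp_add)
  ultimately show ?thesis
    by (simp add: mult_ac)
qed

lemma equiv_orb_ell_eq_LG_ell:
  assumes "is_phase_choice H th" "Im \<tau> > 0" "\<And>i. \<rho> i = of_nat (w i) / of_nat D"
  shows "equiv_orb_ell H \<rho> z z \<tau> = LG_ell w D H th z \<tau>"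
proof -
  have "theta (of_rat (\<rho> i) * z + of_real (lam g i) - of_real (lam h i) * \<tau> - z) \<tau> /
        theta (of_rat (\<rho> i) * z + of_real (lam g i) - of_real (lam h i) * \<tau>) \<tau> *
        exp (2 * of_real pi * \<i> * of_real (lam h i) * z) =
      exp (2 * of_real pi * \<i> * of_rat (th h i) * z) *
        (theta ((of_nat (w i) / of_nat D - 1) * z + of_rat (th g i) - \<tau> * of_rat (th h i)) \<tau> /
         theta (of_nat (w i) / of_nat D * z + of_rat (th g i) - \<tau> * of_rat (th h i)) \<tau>)"
    if gh: "g \<in> H" "h \<in> H" for g h i
  proof -
    obtain n where n: "complex_of_rat (th g i) = of_real (lam g i) + of_int n"
      using phase_choice_eq_lam[OF assms(1) gh(1)] .
    obtain m where m: "complex_of_rat (th h i) = of_real (lam h i) + of_int m"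
      using phase_choice_eq_lam[OF assms(1) gh(2)] .
    \<comment> \<open>As u = z, both numerators sit at the denominator's argument minus z, so both
      sides are values of \<open>theta_ratio\<close>.\<close>
    have e: "(of_nat (w i) / of_nat D - 1) * z + of_rat (th g i) - \<tau> * of_rat (th h i) =
        of_nat (w i) / of_nat D * z + of_rat (th g i) - \<tau> * of_rat (th h i) - z"
      by (simp add: algebra_simps)
    have \<rho>: "of_rat (\<rho> i) = (of_nat (w i) / of_nat D :: complex)"
      by (simp add: assms(3) of_rat_divide)
    show ?thesis
      unfolding e \<rho>
      using genus_factor_eq[OF assms(2) n m, where x = "of_nat (w i) / of_nat D * z" and z = z]
      unfolding theta_ratio_def by (rule sym)
  qed
  then show ?thesis
    unfolding equiv_orb_ell_def LG_ell_def
    \<comment> \<open>The outer index is g, matching \<open>hb\<close>, on one side and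
      \<open>ha\<close>, matching h, on the other.\<close>
    by (subst sum.swap, intro arg_cong[where f = "\<lambda>s. _ * s"] sum.cong prod.cong refl)
qed

theorem proposition4p8:
  fixes w :: "'n::finite \<Rightarrow> nat" and D :: nat and k :: int
    and W :: "('n \<Rightarrow>\<^sub>0 nat) \<Rightarrow>\<^sub>0 complex"
    and th :: "complex ^ 'n \<Rightarrow> 'n \<Rightarrow> rat" and z \<tau> :: complex
  assumes "\<And>i. w i > 0" and "D > 0"
    and "W \<noteq> 0" and "weighted_homogeneous w D W"
    and "k < 0"
    and "is_phase_choice (J_group w D) th"
    and "Im \<tau> > 0"
  shows "range (phase_chart w D k) = git_quotient w D k \<and>
         (\<forall>x y. phase_chart w D k x = phase_chart w D k y \<longleftrightarrow> (\<exists>g\<in>J_group w D. y = g * x)) \<and>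
         fixed_points w D k = {phase_chart w D k 0} \<and>
         phase_ell w D k z \<tau> = LG_ell w D (J_group w D) th z \<tau>"
proof -
  have "card (ineffective_kernel w D k) = 1"
    using ineffective_kernel_eq[OF assms(2,5,3,4)] by simp
  then have "phase_ell w D k z \<tau> = LG_ell w D (J_group w D) th z \<tau>"
    unfolding phase_ell_def
    by (intro equiv_orb_ell_eq_LG_ell assms) (simp add: lifted_weights_eq[OF assms(2,5)])
  then show ?thesis
    by (intro conjI allI range_phase_chart phase_chart_eq_iff fixed_points_eq assms)
qed

end
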